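(* Let $(S,X,\omega)$ be a weighted semitopological transformation semigroup and $f\in C(X,\omega)$. Then: (1) $f\in RUC(X,\omega)$ if and only if $L_{S_\omega}f$ is equicontinuous. (2) $f\in LUC(X,\omega)$ if and only if $R_{S_\omega}f$ is equicontinuous.
   Context: A semitopological semigroup is a semigroup with a topology for which multiplication is separately continuous. A weighted semitopological transformation semigroup $(S,X,\omega)$ consists of a semitopological semigroup $S$, a semitopological semigroup $X$ with identity $e$, an action $S\times X\to X$, $(s,x)\mapsto sx$, with $s(tx)=(st)x$ for all $s,t\in S$, $x\in X$, which is separately continuous, and a weight $\omega$ on $X$, i.e. $\omega:X\to\mathbb{R}^+$ (positive reals) with $\omega(xy)\le\omega(x)\omega(y)$ for all $x,y\in X$ and with $\omega$ and $\omega^{-1}$ bounded on compact subsets of $X$. Put $\Omega:X\times X\to(0,1]$, $\Omega(x,y)=\frac{\omega(xy)}{\omega(x)\omega(y)}$, and ${}_s\Omega(x)=\Omega(se,x)=\Omega_x(s)$ for $s\in S$, $x\in X$ (so ${}_s\Omega$ is a function on $X$ and $\Omega_x$ a function on $S$). Standing assumption: $\Omega$ is separately continuous. $C(X)$ and $C(S)$ denote the bounded continuous real-valued functions on $X$ and $S$ with the sup norm. For a function $g$ on $X$, $s\in S$, $x\in X$: ${}_sg(x)=g(sx)=g_x(s)$ (so ${}_sg$ is a function on $X$ and $g_x$ a function on $S$). $C(X,\omega)=\{f\in C(X): f/\omega\in C(X)\}$. For $f\in C(X,\omega)$, $L_{S_\omega}f=\{{}_s(f/\omega)\,{}_s\Omega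 : s\in S\}$ (a family of functions on $X$) and $R_{S_\omega}f=\{(f/\omega)_x\,\Omega_x : x\in X\}$ (a family of functions on $S$). $LUC(X,\omega)$ is the set of $f\in C(X,\omega)$ such that the map $s\mapsto {}_s(f/\omega)\,{}_s\Omega$, $S\to C(X)$, is norm continuous. $RUC(X,\omega)$ is the set of $f\in C(X,\omega)$ such that the map $x\mapsto (f/\omega)_x\,\Omega_x$, $X\to C(S)$, is norm continuous. A family $\{f_\alpha:\alpha\in I\}$ of real functions on a topological space $Z$ is equicontinuous if for every $\varepsilon>0$ and $z_0\in Z$ there is a neighborhood $N$ of $z_0$ such that $|f_\alpha(z)-f_\alpha(z_0)|<\varepsilon$ for every $z\in N$ and $\alpha\in I$. *)

theory Defs
  imports "HOL-Analysis.Bounded_Continuous_Function"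
begin

definition separately_continuous ::
    "('a::topological_space \<Rightarrow> 'b::topological_space \<Rightarrow> 'c::topological_space) \<Rightarrow> bool" where
  "separately_continuous h \<longleftrightarrow>
     (\<forall>a. continuous_on UNIV (\<lambda>b. h a b)) \<and> (\<forall>b. continuous_on UNIV (\<lambda>a. h a b))"

definition weight :: "('x::{topological_space, semigroup_mult} \<Rightarrow> real) \<Rightarrow> bool" where
  "weight \<omega> \<longleftrightarrow>
     (\<forall>x. \<omega> x > 0) \<and>
     (\<forall>x y. \<omega> (x * y) \<le> \<omega> x * \<omega> y) \<and>
     (\<forall>K. compact K \<longrightarrow> bounded (\<omega> ` K) \<and> bounded ((\<lambda>x. inverse (\<omega> x)) ` K))"

text \<open>\<open>S\<close> and \<open>X\<close> are types, and the identity of \<open>X\<close> is \<open>1\<close>. No separation axiom is assumed.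
  The action is not required to be compatible with the multiplication of \<open>X\<close>, nor is an
  identity of \<open>S\<close> (if there is one) required to act trivially.\<close>

locale weighted_semitopological_transformation_semigroup =
  fixes act :: "'s::{topological_space, semigroup_mult}
      \<Rightarrow> 'x::{topological_space, monoid_mult} \<Rightarrow> 'x"
    and \<omega> :: "'x \<Rightarrow> real"
  assumes separately_continuous_mult_S: "separately_continuous ((*) :: 's \<Rightarrow> 's \<Rightarrow> 's)"
    and separately_continuous_mult_X: "separately_continuous ((*) :: 'x \<Rightarrow> 'x \<Rightarrow> 'x)"
    and act_act: "act s (act t x) = act (s * t) x"
    and separately_continuous_act: "separately_continuous act"
    and weight: "weight \<omega>"

definition weight_ratio :: "('x::semigroup_mult \<Rightarrow> real) \<Rightarrow> 'x \<Rightarrow> 'x \<Rightarrow> real" where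
  "weight_ratio \<omega> x y = \<omega> (x * y) / (\<omega> x * \<omega> y)"

text \<open>\<open>left_translate act s g\<close> is the function ${}_s g$ on \<open>X\<close>, and
  \<open>right_translate act x g\<close> is the function $g_x$ on \<open>S\<close>.\<close>

definition left_translate :: "('s \<Rightarrow> 'x \<Rightarrow> 'x) \<Rightarrow> 's \<Rightarrow> ('x \<Rightarrow> real) \<Rightarrow> 'x \<Rightarrow> real" where
  "left_translate act s g = (\<lambda>x. g (act s x))"

definition right_translate :: "('s \<Rightarrow> 'x \<Rightarrow> 'x) \<Rightarrow> 'x \<Rightarrow> ('x \<Rightarrow> real) \<Rightarrow> 's \<Rightarrow> real" where
  "right_translate act x g = (\<lambda>s. g (act s x))"

text \<open>\<open>left_ratio act \<omega> s\<close> is ${}_s\Omega$ and \<open>right_ratio act \<omega> x\<close> is $\Omega_x$. These are not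
  translates of \<open>\<Omega>\<close> in the sense above: the element \<open>s\<close> enters through \<open>se\<close>.\<close>

definition left_ratio ::
    "('s \<Rightarrow> 'x \<Rightarrow> 'x) \<Rightarrow> ('x::monoid_mult \<Rightarrow> real) \<Rightarrow> 's \<Rightarrow> 'x \<Rightarrow> real" where
  "left_ratio act \<omega> s = (\<lambda>x. weight_ratio \<omega> (act s 1) x)"

definition right_ratio ::
    "('s \<Rightarrow> 'x \<Rightarrow> 'x) \<Rightarrow> ('x::monoid_mult \<Rightarrow> real) \<Rightarrow> 'x \<Rightarrow> 's \<Rightarrow> real" where
  "right_ratio act \<omega> x = (\<lambda>s. weight_ratio \<omega> (act s 1) x)"

definition weighted_left_translate ::
    "('s \<Rightarrow> 'x \<Rightarrow> 'x) \<Rightarrow> ('x::monoid_mult \<Rightarrow> real) \<Rightarrow> ('x \<Rightarrow> real) \<Rightarrow> 's \<Rightarrow> 'x \<Rightarrow> real" where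
  "weighted_left_translate act \<omega> f s =
     (\<lambda>x. left_translate act s (\<lambda>y. f y / \<omega> y) x * left_ratio act \<omega> s x)"

definition weighted_right_translate ::
    "('s \<Rightarrow> 'x \<Rightarrow> 'x) \<Rightarrow> ('x::monoid_mult \<Rightarrow> real) \<Rightarrow> ('x \<Rightarrow> real) \<Rightarrow> 'x \<Rightarrow> 's \<Rightarrow> real" where
  "weighted_right_translate act \<omega> f x =
     (\<lambda>s. right_translate act x (\<lambda>y. f y / \<omega> y) s * right_ratio act \<omega> x s)"

definition C_weighted :: "('x::topological_space \<Rightarrow> real) \<Rightarrow> ('x \<Rightarrow> real) set" where
  "C_weighted \<omega> = {f \<in> bcontfun. (\<lambda>x. f x / \<omega> x) \<in> bcontfun}"

definition L_family ::
    "('s \<Rightarrow> 'x \<Rightarrow> 'x) \<Rightarrow> ('x::monoid_mult \<Rightarrow> real) \<Rightarrow> ('x \<Rightarrow> real) \<Rightarrow> ('x \<Rightarrow> real) set" where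
  "L_family act \<omega> f = range (\<lambda>s. weighted_left_translate act \<omega> f s)"

definition R_family ::
    "('s \<Rightarrow> 'x \<Rightarrow> 'x) \<Rightarrow> ('x::monoid_mult \<Rightarrow> real) \<Rightarrow> ('x \<Rightarrow> real) \<Rightarrow> ('s \<Rightarrow> real) set" where
  "R_family act \<omega> f = range (\<lambda>x. weighted_right_translate act \<omega> f x)"

text \<open>Norm continuity is continuity into the normed space of bounded continuous functions.
  The arguments of \<open>Bcontfun\<close> below do lie in \<open>bcontfun\<close> when \<open>\<Omega>\<close> is separately continuous; see
  \<open>weighted_left_translate_bcontfun\<close> and \<open>weighted_right_translate_bcontfun\<close>.\<close>

definition LUC :: "('s::topological_space \<Rightarrow> 'x \<Rightarrow> 'x)
    \<Rightarrow> ('x::{topological_space, monoid_mult} \<Rightarrow> real) \<Rightarrow> ('x \<Rightarrow> real) set" where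
  "LUC act \<omega> = {f \<in> C_weighted \<omega>.
     continuous_on UNIV (\<lambda>s. Bcontfun (weighted_left_translate act \<omega> f s) :: 'x \<Rightarrow>\<^sub>C real)}"

definition RUC :: "('s::topological_space \<Rightarrow> 'x \<Rightarrow> 'x)
    \<Rightarrow> ('x::{topological_space, monoid_mult} \<Rightarrow> real) \<Rightarrow> ('x \<Rightarrow> real) set" where
  "RUC act \<omega> = {f \<in> C_weighted \<omega>.
     continuous_on UNIV (\<lambda>x. Bcontfun (weighted_right_translate act \<omega> f x) :: 's \<Rightarrow>\<^sub>C real)}"

definition equicontinuous :: "('z::topological_space \<Rightarrow> real) set \<Rightarrow> bool" where
  "equicontinuous F \<longleftrightarrow>
     (\<forall>\<epsilon>>0. \<forall>z0. \<forall>\<^sub>F z in nhds z0. \<forall>g\<in>F. \<bar>g z - g z0\<bar> < \<epsilon>)"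

context weighted_semitopological_transformation_semigroup
begin

lemma weight_ratio_bounds: "0 < weight_ratio \<omega> x y \<and> weight_ratio \<omega> x y \<le> 1"
  using weight by (simp add: weight_def weight_ratio_def)

lemma weighted_product_bounded:
  assumes "f \<in> C_weighted \<omega>"
  shows "bounded (range (\<lambda>z. f (p z) / \<omega> (p z) * weight_ratio \<omega> (q z) (r z)))"
proof -
  obtain B where B: "\<And>x. \<bar>f x / \<omega> x\<bar> \<le> B"
    using assms by (auto simp: C_weighted_def bcontfun_def bounded_iff)
  have "\<bar>f (p z) / \<omega> (p z) * weight_ratio \<omega> (q z) (r z)\<bar> \<le> B" for z
  proof -
    have "\<bar>f (p z) / \<omega> (p z)\<bar> * \<bar>weight_ratio \<omega> (q z) (r z)\<bar> \<le> \<bar>f (p z) / \<omega> (p z)\<bar> * 1"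
      using weight_ratio_bounds[of "q z" "r z"] by (intro mult_left_mono) auto
    then show ?thesis
      using B[of "p z"] by (simp add: abs_mult)
  qed
  then show ?thesis
    unfolding bounded_iff by auto
qed

lemma weighted_left_translate_bcontfun:
  assumes "separately_continuous (weight_ratio \<omega>)" "f \<in> C_weighted \<omega>"
  shows "weighted_left_translate act \<omega> f s \<in> bcontfun"
proof -
  have f: "continuous_on UNIV (\<lambda>x. f x / \<omega> x)"
    using assms(2) by (simp add: C_weighted_def bcontfun_def)
  have a: "continuous_on UNIV (\<lambda>x. act s x)"
    using separately_continuous_act by (simp add: separately_continuous_def)
  have r: "continuous_on UNIV (\<lambda>x. weight_ratio \<omega> (act s 1) x)"
    using assms(1) by (simp add: separately_continuous_def)
  show ?thesis
    using continuous_on_mult[OF continuous_on_compose2[OF f a] r]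
      weighted_product_bounded[OF assms(2)]
    by (simp add: bcontfun_def weighted_left_translate_def left_translate_def left_ratio_def)
qed

lemma weighted_right_translate_bcontfun:
  assumes "separately_continuous (weight_ratio \<omega>)" "f \<in> C_weighted \<omega>"
  shows "weighted_right_translate act \<omega> f x \<in> bcontfun"
proof -
  have f: "continuous_on UNIV (\<lambda>x. f x / \<omega> x)"
    using assms(2) by (simp add: C_weighted_def bcontfun_def)
  have a: "continuous_on UNIV (\<lambda>s. act s y)" for y
    using separately_continuous_act by (simp add: separately_continuous_def)
  have r: "continuous_on UNIV (\<lambda>y. weight_ratio \<omega> y x)"
    using assms(1) by (simp add: separately_continuous_def)
  show ?thesis
    using continuous_on_mult[OF continuous_on_compose2[OF f a] continuous_on_compose2[OF r a]]
      weighted_product_bounded[OF assms(2)]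
    by (simp add: bcontfun_def weighted_right_translate_def right_translate_def right_ratio_def)
qed

end

end

theory Submission
  imports Defs
begin

text \<open>The weighted left and right translates are the two partial functions of the single kernel
  \<open>k s x = f (s x) / \<omega> (s x) * \<Omega> (s e, x)\<close> on \<open>S \<times> X\<close>. So both parts are instances of one fact
  about a real kernel \<open>h\<close> of two variables, \<open>continuous_Bcontfun_iff_equicontinuous\<close>: norm
  continuity of \<open>a \<mapsto> h a\<close> at \<open>a0\<close> says that \<open>h a b\<close> is close to \<open>h a0 b\<close> uniformly in \<open>b\<close> once
  \<open>a\<close> is close to \<open>a0\<close>, and equicontinuity at \<open>a0\<close> of the functions \<open>a \<mapsto> h a b\<close>, indexed by \<open>b\<close>,
  says the same. Since \<open>f / \<omega>\<close> is bounded and continuous, \<open>0 < \<Omega> \<le> 1\<close>, and the action and \<open>\<Omega>\<close>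
  are separately continuous, every partial function of \<open>k\<close> is bounded and continuous. Part (1)
  takes \<open>h x s = k s x\<close>, part (2) takes \<open>h s x = k s x\<close>.\<close>

text \<open>The two sides differ only in that the supremum over \<open>b\<close> of differences that are all
  less than \<open>\<epsilon>\<close> may equal \<open>\<epsilon>\<close>; halving \<open>\<epsilon>\<close> removes this.\<close>

lemma continuous_Bcontfun_iff_equicontinuous:
  fixes h :: "'a::topological_space \<Rightarrow> 'b::topological_space \<Rightarrow> real"
  assumes h: "\<And>a. h a \<in> bcontfun"
  shows "continuous_on UNIV (\<lambda>a. Bcontfun (h a)) \<longleftrightarrow> equicontinuous (range (\<lambda>b a. h a b))"
proof -
  have apply_h: "apply_bcontfun (Bcontfun (h a)) b = h a b" for a b
    using h by (simp add: Bcontfun_inverse)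
  have cont_iff: "continuous_on UNIV (\<lambda>a. Bcontfun (h a)) \<longleftrightarrow>
      (\<forall>a0. \<forall>\<epsilon>>0. \<forall>\<^sub>F a in nhds a0. dist (Bcontfun (h a)) (Bcontfun (h a0)) < \<epsilon>)"
    by (simp add: continuous_on_def tendsto_iff eventually_nhds_conv_at)
  have equi_iff: "equicontinuous (range (\<lambda>b a. h a b)) \<longleftrightarrow>
      (\<forall>\<epsilon>>0. \<forall>a0. \<forall>\<^sub>F a in nhds a0. \<forall>b. \<bar>h a b - h a0 b\<bar> < \<epsilon>)"
    by (simp add: equicontinuous_def)
  have pointwise: "\<bar>h a b - h a0 b\<bar> \<le> dist (Bcontfun (h a)) (Bcontfun (h a0))" for a a0 b
    using dist_bounded[of "Bcontfun (h a)" b "Bcontfun (h a0)"]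
    by (simp add: apply_h dist_real_def)
  have uniform: "dist (Bcontfun (h a)) (Bcontfun (h a0)) < \<epsilon>"
    if "\<epsilon> > 0" and "\<forall>b. \<bar>h a b - h a0 b\<bar> < \<epsilon> / 2" for a a0 \<epsilon>
  proof -
    have "dist (Bcontfun (h a)) (Bcontfun (h a0)) \<le> \<epsilon> / 2"
      using that(2) by (intro dist_bound) (simp add: apply_h dist_real_def less_imp_le)
    with \<open>\<epsilon> > 0\<close> show ?thesis
      by simp
  qed
  show ?thesis
    unfolding cont_iff equi_iff
  proof (intro iffI allI impI)
    fix \<epsilon> :: real and a0 :: 'a
    assume "\<forall>a0. \<forall>\<epsilon>>0. \<forall>\<^sub>F a in nhds a0. dist (Bcontfun (h a)) (Bcontfun (h a0)) < \<epsilon>"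
      and "\<epsilon> > 0"
    then have "\<forall>\<^sub>F a in nhds a0. dist (Bcontfun (h a)) (Bcontfun (h a0)) < \<epsilon>"
      by blast
    then show "\<forall>\<^sub>F a in nhds a0. \<forall>b. \<bar>h a b - h a0 b\<bar> < \<epsilon>"
      by (rule eventually_mono) (blast intro: le_less_trans pointwise)
  next
    fix \<epsilon> :: real and a0 :: 'a
    assume "\<forall>\<epsilon>>0. \<forall>a0. \<forall>\<^sub>F a in nhds a0. \<forall>b. \<bar>h a b - h a0 b\<bar> < \<epsilon>" and "\<epsilon> > 0"
    then have "\<forall>\<^sub>F a in nhds a0. \<forall>b. \<bar>h a b - h a0 b\<bar> < \<epsilon> / 2"
      by (meson half_gt_zero)
    then show "\<forall>\<^sub>F a in nhds a0. dist (Bcontfun (h a)) (Bcontfun (h a0)) < \<epsilon>"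
      by (rule eventually_mono) (rule uniform[OF \<open>\<epsilon> > 0\<close>])
  qed
qed

lemma weighted_right_translate_eq_left:
  "weighted_right_translate act \<omega> f x s = weighted_left_translate act \<omega> f s x"
  by (simp add: weighted_right_translate_def weighted_left_translate_def
      right_translate_def left_translate_def right_ratio_def left_ratio_def)

theorem proposition2p8:
  fixes act :: "'s::{topological_space, semigroup_mult}
      \<Rightarrow> 'x::{topological_space, monoid_mult} \<Rightarrow> 'x"
    and \<omega> f :: "'x \<Rightarrow> real"
  assumes "weighted_semitopological_transformation_semigroup act \<omega>"
    and "separately_continuous (weight_ratio \<omega>)"
    and "f \<in> C_weighted \<omega>"
  shows "(f \<in> RUC act \<omega> \<longleftrightarrow> equicontinuous (L_family act \<omega> f)) \<and>
         (f \<in> LUC act \<omega> \<longleftrightarrow> equicontinuous (R_family act \<omega> f))"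
proof -
  interpret weighted_semitopological_transformation_semigroup act \<omega>
    by (rule assms(1))
  have L: "L_family act \<omega> f = range (\<lambda>s x. weighted_right_translate act \<omega> f x s)"
    by (simp add: L_family_def weighted_right_translate_eq_left)
  have R: "R_family act \<omega> f = range (\<lambda>x s. weighted_left_translate act \<omega> f s x)"
    by (simp add: R_family_def weighted_right_translate_eq_left[symmetric])
  show ?thesis
    unfolding L R
    using assms(3)
      continuous_Bcontfun_iff_equicontinuous[of "weighted_right_translate act \<omega> f",
        OF weighted_right_translate_bcontfun[OF assms(2,3)]]
      continuous_Bcontfun_iff_equicontinuous[of "weighted_left_translate act \<omega> f",
        OF weighted_left_translate_bcontfun[OF assms(2,3)]]
    by (simp add: RUC_def LUC_def)
qed

end
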